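(* Let $m_H,m_L\ge 1$ be integers, $m=m_H+m_L$, and let $0<\sigma_L^2\le\sigma_H^2$. For a labelled constellation $\mathbf{z}\in\mathbb{C}^{2^m}$ let $r_H(\mathbf{z})$, $r_L(\mathbf{z})$ be the BICM-SIC rates over the AWGN channels with noise parameters $\sigma_H^2$ and $\sigma_L^2$ (defined in the context). Then amplifying a constellation does not decrease its BICM-SIC rates: for every $\mathbf{z}\in\mathbb{C}^{2^m}$ and every real $\rho>1$, with $\rho\mathbf{z}$ the constellation obtained by multiplying every entry of $\mathbf{z}$ by $\rho$ and keeping the labels, $$r_H(\rho\mathbf{z})\ge r_H(\mathbf{z})\qquad\text{and}\qquad r_L(\rho\mathbf{z})\ge r_L(\mathbf{z}).$$
   Context: A hierarchical constellation of order $2^m$, $m=m_H+m_L$, is a vector $\mathbf{z}\in\mathbb{C}^{2^m}$ whose entries are indexed by binary labels $(\mathbf{b}_H,\mathbf{b}_L)\in\{0,1\}^{m_H}\times\{0,1\}^{m_L}$ (the labelling is fixed; entries with different labels are allowed to coincide). The entry with label $(\mathbf{b}_H,\mathbf{b}_L)$ is the transmitted symbol for the high-priority bits $\mathbf{b}_H=(b_H^1,\dots,b_H^{m_H})$ and low-priority bits $\mathbf{b}_L=(b_L^1,\dots,b_L^{m_L})$. Let $(\mathbf{B}_H,\mathbf{B}_L)$ be uniformly distributed on $\{0,1\}^{m_H}\times\{0,1\}^{m_L}$ (so all bits are independent and uniform), and let $Z$ be the entry of $\mathbf{z}$ with label $(\mathbf{B}_H,\mathbf{B}_L)$. The received signals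 are $Y_H=Z+N_H$ and $Y_L=Z+N_L$, where $N_H,N_L$ are circularly symmetric complex Gaussian noises independent of $(\mathbf{B}_H,\mathbf{B}_L)$; the channel transition density (with respect to Lebesgue measure on $\mathbb{C}\cong\mathbb{R}^2$) is $p(y|z)=\frac{1}{2\pi\sigma^2}e^{-\|y-z\|^2/(2\sigma^2)}$, with $\sigma^2=\sigma_H^2$ for $Y_H$ and $\sigma^2=\sigma_L^2$ for $Y_L$. The BICM-SIC rates (bit-interleaved coded modulation with successive interference cancellation) are $$r_H(\mathbf{z})=\sum_{i=1}^{m_H} I(B_H^i;Y_H),\qquad r_L(\mathbf{z})=\sum_{j=1}^{m_L} I(B_L^j;Y_L\mid\mathbf{B}_H),$$ where $I(\cdot\,;\cdot)$ and $I(\cdot\,;\cdot\mid\cdot)$ denote mutual information and conditional mutual information in base 2. *)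

theory Defs
  imports "HOL-Probability.Probability"
begin

text \<open>
  A labelled constellation is a map from labels \<open>(b\<^sub>H, b\<^sub>L)\<close> to symbols; bit strings are
  lists of booleans, indexed from 0. Only the values on \<open>labels mH mL\<close> matter, so such maps
  represent the vectors in \<open>\<complex>\<close> to the power \<open>2 ^ (mH + mL)\<close>.
\<close>

type_synonym label = "bool list \<times> bool list"

definition labels :: "nat \<Rightarrow> nat \<Rightarrow> label set" where
  "labels mH mL = {bs. length bs = mH} \<times> {bs. length bs = mL}"

definition awgn_density :: "real \<Rightarrow> complex \<Rightarrow> complex \<Rightarrow> real" where
  "awgn_density \<sigma> z y = 1 / (2 * pi * \<sigma>\<^sup>2) * exp (- (norm (y - z))\<^sup>2 / (2 * \<sigma>\<^sup>2))"

definition noise :: "real \<Rightarrow> complex measure" where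
  "noise \<sigma> = density lborel (\<lambda>n. ennreal (awgn_density \<sigma> 0 n))"

text \<open>
  Sample space of one channel use: a uniform label and, independently of it, the noise.
  Each rate involves only one of the two received signals, so the joint law of the two noises
  is irrelevant and each rate is computed on the sample space of its own channel.
\<close>

definition channel_space :: "nat \<Rightarrow> nat \<Rightarrow> real \<Rightarrow> (label \<times> complex) measure" where
  "channel_space mH mL \<sigma> = measure_pmf (pmf_of_set (labels mH mL)) \<Otimes>\<^sub>M noise \<sigma>"

definition high_bits :: "label \<times> complex \<Rightarrow> bool list" where
  "high_bits \<omega> = fst (fst \<omega>)"

definition low_bits :: "label \<times> complex \<Rightarrow> bool list" where
  "low_bits \<omega> = snd (fst \<omega>)"

definition received :: "(label \<Rightarrow> complex) \<Rightarrow> label \<times> complex \<Rightarrow> complex" where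
  "received z \<omega> = z (fst \<omega>) + snd \<omega>"

definition rate_H :: "nat \<Rightarrow> nat \<Rightarrow> real \<Rightarrow> (label \<Rightarrow> complex) \<Rightarrow> real" where
  "rate_H mH mL \<sigma> z =
    (\<Sum>i<mH. prob_space.mutual_information (channel_space mH mL \<sigma>) 2
       (count_space UNIV) borel
       (\<lambda>\<omega>. high_bits \<omega> ! i) (received z))"

text \<open>
  The library's conditional mutual information \<open>I(X; Y | Z)\<close> is given by the chain rule
  \<open>I(X; Y, Z) - I(X; Z)\<close>.
\<close>

definition rate_L :: "nat \<Rightarrow> nat \<Rightarrow> real \<Rightarrow> (label \<Rightarrow> complex) \<Rightarrow> real" where
  "rate_L mH mL \<sigma> z =
    (\<Sum>j<mL. prob_space.conditional_mutual_information (channel_space mH mL \<sigma>) 2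
       (count_space UNIV) borel (count_space UNIV)
       (\<lambda>\<omega>. low_bits \<omega> ! j) (received z) high_bits)"

lemma labels_finite_nonempty: "finite (labels mH mL)" "labels mH mL \<noteq> {}"
proof -
  have *: "finite {bs :: bool list. length bs = n}" "{bs :: bool list. length bs = n} \<noteq> {}" for n
    using finite_lists_length_eq[of "UNIV :: bool set" n] Ex_list_of_length[of n] by auto
  show "finite (labels mH mL)" "labels mH mL \<noteq> {}"
    unfolding labels_def using *[of mH] *[of mL] by auto
qed

lemma card_labels: "card (labels mH mL) = 2 ^ (mH + mL)"
  using card_lists_length_eq[of "UNIV :: bool set"]
  by (simp add: labels_def card_cartesian_product power_add)

lemma awgn_density_prod:
  assumes "\<sigma> \<noteq> 0"
  shows "awgn_density \<sigma> 0 y = (\<Prod>b\<in>Basis. normal_density 0 \<bar>\<sigma>\<bar> (y \<bullet> b))"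
proof -
  have "sqrt (2 * pi * \<sigma>\<^sup>2) * sqrt (2 * pi * \<sigma>\<^sup>2) = 2 * pi * \<sigma>\<^sup>2" by simp
  then show ?thesis
    unfolding awgn_density_def normal_density_def Basis_complex_def
    by (simp add: cmod_power2 exp_add[symmetric] add_divide_distrib diff_divide_distrib)
qed

lemma prob_space_noise:
  assumes "\<sigma> \<noteq> 0"
  shows "prob_space (noise \<sigma>)"
proof
  have 1: "(\<integral>\<^sup>+x. ennreal (normal_density 0 \<bar>\<sigma>\<bar> x) \<partial>lborel) = 1"
    using assms nn_integral_eq_integral[of lborel "normal_density 0 \<bar>\<sigma>\<bar>"]
    by (simp add: integral_normal_density integrable_normal_density)
  have "emeasure (noise \<sigma>) (space (noise \<sigma>)) = (\<integral>\<^sup>+y. ennreal (awgn_density \<sigma> 0 y) \<partial>lborel)"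
    unfolding noise_def by (subst emeasure_density) (auto simp: awgn_density_def)
  also have "\<dots> = (\<integral>\<^sup>+y. (\<Prod>b\<in>Basis. ennreal (normal_density 0 \<bar>\<sigma>\<bar> ((y::complex) \<bullet> b))) \<partial>lborel)"
    by (simp add: awgn_density_prod[OF assms] prod_ennreal)
  also have "\<dots> = 1"
    by (subst nn_integral_lborel_prod) (auto simp: 1)
  finally show "emeasure (noise \<sigma>) (space (noise \<sigma>)) = 1" .
qed

lemma prob_space_channel_space:
  assumes "\<sigma> \<noteq> 0"
  shows "prob_space (channel_space mH mL \<sigma>)"
  unfolding channel_space_def
  by (intro prob_space_pair prob_space_noise assms measure_pmf.prob_space_axioms)

lemma measurable_high_bits [measurable]:
  "high_bits \<in> channel_space mH mL \<sigma> \<rightarrow>\<^sub>M count_space UNIV"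
  unfolding high_bits_def[abs_def] channel_space_def
  by (rule measurable_compose[OF measurable_fst]) simp

lemma measurable_low_bits [measurable]:
  "low_bits \<in> channel_space mH mL \<sigma> \<rightarrow>\<^sub>M count_space UNIV"
  unfolding low_bits_def[abs_def] channel_space_def
  by (rule measurable_compose[OF measurable_fst]) simp

lemma measurable_received [measurable]:
  "received z \<in> borel_measurable (channel_space mH mL \<sigma>)"
proof -
  have "(\<lambda>\<omega>. z (fst \<omega>)) \<in> borel_measurable (channel_space mH mL \<sigma>)"
    unfolding channel_space_def
    by (rule measurable_compose[OF measurable_fst]) simp
  moreover have "snd \<in> borel_measurable (channel_space mH mL \<sigma>)"
    unfolding channel_space_def
    using measurable_snd[of "measure_pmf (pmf_of_set (labels mH mL))" "noise \<sigma>"]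
    by (simp add: noise_def cong: measurable_cong_sets)
  ultimately show ?thesis
    unfolding received_def[abs_def] by (rule borel_measurable_add)
qed

end

(*
  Dividing the signal received from the amplified constellation \<rho> z by \<rho> and adding independent
  Gaussian noise of variance \<sigma>\<^sup>2 (1 - 1 / \<rho>\<^sup>2) per real dimension yields a signal distributed as the
  one received from z. So the joint density p' of (bit, signal) for z arises from the density p
  for \<rho> z by a stochastic kernel K, and the rates decrease by the data processing inequality.
  With marginal densities q, q', the latter follows for each bit value from Jensen's inequality
  for ln, used in the tangent form
    f ln (g / f) + f \<le> f ln (1 / r) + g r   with f = p, g = q and r = p' / q',
  in which all terms are nonnegative, so that integrating against K needs only Tonelli's theorem.
*)
theory Submission
  imports Defs
begin

section \<open>Gaussian densities and their factorization\<close>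

lemma awgn_density_nonneg: "0 \<le> awgn_density \<sigma> z y"
  by (simp add: awgn_density_def)

lemma awgn_density_measurable [measurable]:
  "(\<lambda>(z, y). awgn_density \<sigma> z y) \<in> borel_measurable (borel \<Otimes>\<^sub>M borel)"
  unfolding awgn_density_def by measurable

lemma awgn_density_shift: "awgn_density \<sigma> z y = awgn_density \<sigma> 0 (y - z)"
  by (simp add: awgn_density_def)

text \<open>Translation invariance of Lebesgue measure moves the centre to 0, where the integral is
  the total mass of \<open>noise \<sigma>\<close>.\<close>

lemma nn_integral_awgn_density:
  assumes "\<sigma> \<noteq> 0"
  shows "(\<integral>\<^sup>+ y. ennreal (awgn_density \<sigma> z y) \<partial>lborel) = 1"
proof -
  interpret prob_space "noise \<sigma>" using assms by (rule prob_space_noise)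
  have "(\<integral>\<^sup>+ y. ennreal (awgn_density \<sigma> 0 (y - z)) \<partial>lborel)
      = (\<integral>\<^sup>+ y. ennreal (awgn_density \<sigma> 0 y) \<partial>distr lborel borel ((+) (- z)))"
    by (subst nn_integral_distr) (auto simp: algebra_simps)
  also have "\<dots> = (\<integral>\<^sup>+ y. ennreal (awgn_density \<sigma> 0 y) \<partial>lborel)"
    by (simp add: lborel_distr_plus)
  also have "\<dots> = emeasure (noise \<sigma>) (space (noise \<sigma>))"
    unfolding noise_def by (subst emeasure_density) auto
  finally show ?thesis
    by (simp add: emeasure_space_1 awgn_density_shift[of \<sigma> z])
qed

text \<open>Completing the square in \<open>u\<close> on the left produces a Gaussian with the same parameter \<open>s\<close>.\<close>

lemma awgn_density_mult:
  fixes y z u :: complex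
  assumes "\<rho> > 1" "\<sigma> \<noteq> 0"
  defines "s \<equiv> sqrt (\<sigma>\<^sup>2 * (1 - 1 / \<rho>\<^sup>2))"
  shows "awgn_density s (u / of_real \<rho>) y * awgn_density \<sigma> (of_real \<rho> * z) u
       = awgn_density \<sigma> z y * awgn_density s (y / of_real \<rho> + of_real (\<rho> - 1 / \<rho>) * z) u"
proof -
  have r2: "\<rho>\<^sup>2 > 1" using assms by (simp add: one_less_power)
  have s2: "s\<^sup>2 = \<sigma>\<^sup>2 * (\<rho>\<^sup>2 - 1) / \<rho>\<^sup>2"
  proof -
    have "1 / \<rho>\<^sup>2 \<le> 1" using r2 by (simp add: divide_le_eq_1)
    then have "s\<^sup>2 = \<sigma>\<^sup>2 * (1 - 1 / \<rho>\<^sup>2)"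
      unfolding s_def by (intro real_sqrt_pow2) simp
    also have "1 - 1 / \<rho>\<^sup>2 = (\<rho>\<^sup>2 - 1) / \<rho>\<^sup>2"
      using \<open>\<rho> > 1\<close> by (simp add: diff_divide_distrib)
    finally show ?thesis by simp
  qed
  \<comment> \<open>The prefactors on the two sides agree, so only exponents have to be compared.
    The centre of the last Gaussian is the conditional mean of \<open>u\<close> given
    \<open>y\<close>, when \<open>u\<close> is Gaussian around \<open>\<rho> * z\<close> and
    \<open>y\<close> is \<open>u / \<rho>\<close> plus independent noise of parameter
    \<open>s\<close>.\<close>
  have "(norm (y - u / of_real \<rho>))\<^sup>2 / (2 * s\<^sup>2) + (norm (u - of_real \<rho> * z))\<^sup>2 / (2 * \<sigma>\<^sup>2)
    = (norm (y - z))\<^sup>2 / (2 * \<sigma>\<^sup>2) + (norm (u - (y / of_real \<rho> + of_real (\<rho> - 1 / \<rho>) * z)))\<^sup>2 / (2 * s\<^sup>2)"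
  proof -
    \<comment> \<open>Squared norms split into real and imaginary parts, so one real identity serves
      both coordinates.\<close>
    have R: "(b - a / \<rho>)\<^sup>2 / (2 * s\<^sup>2) + (a - \<rho> * c)\<^sup>2 / (2 * \<sigma>\<^sup>2)
      = (b - c)\<^sup>2 / (2 * \<sigma>\<^sup>2) + (a - (b / \<rho> + (\<rho> - 1 / \<rho>) * c))\<^sup>2 / (2 * s\<^sup>2)" for a b c
    proof -
      have nz: "\<rho>\<^sup>2 - 1 \<noteq> 0" "\<rho> \<noteq> 0" "2 * \<sigma>\<^sup>2 * (\<rho>\<^sup>2 - 1) \<noteq> 0"
      proof -
        show "\<rho>\<^sup>2 - 1 \<noteq> 0" using r2 by linarith
        then show "\<rho> \<noteq> 0" "2 * \<sigma>\<^sup>2 * (\<rho>\<^sup>2 - 1) \<noteq> 0" using \<open>\<rho> > 1\<close> \<open>\<sigma> \<noteq> 0\<close> by simp_all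
      qed
      \<comment> \<open>Both denominators become
        \<open>2 * \<sigma>\<^sup>2 * (\<rho>\<^sup>2 - 1)\<close>. Then \<open>sq\<close> moves the
        factor \<open>\<rho>\<^sup>2\<close> into the squares, which clears the divisions by
        \<open>\<rho>\<close> and leaves a polynomial identity between the numerators.\<close>
      have m: "x / (2 * s\<^sup>2) = x * \<rho>\<^sup>2 / (2 * \<sigma>\<^sup>2 * (\<rho>\<^sup>2 - 1))"
              "x / (2 * \<sigma>\<^sup>2) = x * (\<rho>\<^sup>2 - 1) / (2 * \<sigma>\<^sup>2 * (\<rho>\<^sup>2 - 1))" for x
        using nz unfolding s2 by (simp_all add: mult.assoc)
      have sq: "x\<^sup>2 * \<rho>\<^sup>2 = (x * \<rho>)\<^sup>2" for x by (simp add: power_mult_distrib)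
      have *: "(b - a / \<rho>) * \<rho> = b * \<rho> - a"
        "(a - (b / \<rho> + (\<rho> - 1 / \<rho>) * c)) * \<rho> = a * \<rho> - b - (\<rho>\<^sup>2 - 1) * c"
        using nz by (simp_all add: algebra_simps power2_eq_square)
      show ?thesis
        unfolding m sq add_divide_distrib[symmetric] *
        by (intro arg_cong2[where f="(/)"] refl) algebra
    qed
    show ?thesis
      unfolding cmod_power2 add_divide_distrib
      using R[of "Re y" "Re u" "Re z"] R[of "Im y" "Im u" "Im z"]
      by (simp add: Re_divide_of_real Im_divide_of_real)
  qed
  then have "exp (- (norm (y - u / of_real \<rho>))\<^sup>2 / (2 * s\<^sup>2)) * exp (- (norm (u - of_real \<rho> * z))\<^sup>2 / (2 * \<sigma>\<^sup>2))
    = exp (- (norm (y - z))\<^sup>2 / (2 * \<sigma>\<^sup>2)) * exp (- (norm (u - (y / of_real \<rho> + of_real (\<rho> - 1 / \<rho>) * z)))\<^sup>2 / (2 * s\<^sup>2))"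
    unfolding exp_add[symmetric] by simp
  then show ?thesis
    unfolding awgn_density_def by (simp only: mult_ac)
qed

section \<open>Relative entropy under a stochastic kernel\<close>

text \<open>Data processing for one bit value: in the application \<open>f\<close> is the joint
  density at that value and \<open>g\<close> the marginal density of the signal. Since
  \<open>f \<le> g\<close>, the integrand is nonnegative and the integral is minus a relative
  entropy, so everything can stay in \<open>ennreal\<close>. The bound is first shown for each fixed
  output \<open>t\<close> (fact \<open>point\<close>) and then integrated over
  \<open>t\<close>.\<close>

lemma kernel_relative_entropy_nn:
  fixes f g :: "'a \<Rightarrow> real" and f' g' :: "'b \<Rightarrow> real" and K :: "'a \<Rightarrow> 'b \<Rightarrow> real"
  assumes T: "sigma_finite_measure T" and T': "sigma_finite_measure T'"
    and [measurable]: "f \<in> borel_measurable T" "g \<in> borel_measurable T"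
    and [measurable]: "case_prod K \<in> borel_measurable (T \<Otimes>\<^sub>M T')"
    and f: "\<And>u. u \<in> space T \<Longrightarrow> 0 \<le> f u" and fg: "\<And>u. u \<in> space T \<Longrightarrow> f u \<le> g u"
    and K: "\<And>u t. u \<in> space T \<Longrightarrow> t \<in> space T' \<Longrightarrow> 0 \<le> K u t"
    and K1: "\<And>u. u \<in> space T \<Longrightarrow> (\<integral>\<^sup>+ t. ennreal (K u t) \<partial>T') = 1"
    and f'0: "\<And>t. t \<in> space T' \<Longrightarrow> 0 \<le> f' t"
    and f': "\<And>t. t \<in> space T' \<Longrightarrow> ennreal (f' t) = (\<integral>\<^sup>+ u. ennreal (K u t * f u) \<partial>T)"
    and g': "\<And>t. t \<in> space T' \<Longrightarrow> ennreal (g' t) = (\<integral>\<^sup>+ u. ennreal (K u t * g u) \<partial>T)"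
  shows "(\<integral>\<^sup>+ u. ennreal (f u * ln (g u / f u)) \<partial>T) \<le> (\<integral>\<^sup>+ t. ennreal (f' t * ln (g' t / f' t)) \<partial>T')"
proof -
  interpret T: sigma_finite_measure T by fact
  interpret T': sigma_finite_measure T' by fact
  interpret TT': pair_sigma_finite T T' ..
  have ln_nonneg: "0 \<le> f u * ln (g u / f u)" if "u \<in> space T" for u
    using f[OF that] fg[OF that] by (cases "f u = 0") auto
  have point: "(\<integral>\<^sup>+ u. ennreal (K u t * (f u * ln (g u / f u))) \<partial>T) \<le> ennreal (f' t * ln (g' t / f' t))"
    if t [measurable]: "t \<in> space T'" for t
  proof (cases "f' t = 0")
    \<comment> \<open>The right-hand side is 0 here. The left one vanishes too, because
      \<open>K u t * f u\<close> is a factor of its integrand and is zero for almost every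
      \<open>u\<close>.\<close>
    case True
    then have "(\<integral>\<^sup>+ u. ennreal (K u t * f u) \<partial>T) = 0"
      using f'[OF t] by simp
    then have "AE u in T. ennreal (K u t * f u) = 0"
      by (subst (asm) nn_integral_0_iff_AE) auto
    then have "AE u in T. ennreal (K u t * (f u * ln (g u / f u))) = 0"
      using AE_space
    proof eventually_elim
      case (elim u)
      then have "K u t * f u = 0"
        using mult_nonneg_nonneg[OF K[OF \<open>u \<in> space T\<close> t] f[OF \<open>u \<in> space T\<close>]]
        by (simp only: ennreal_eq_0_iff)
      then show ?case by auto
    qed
    then show ?thesis
      by (subst nn_integral_cong_AE) auto
  next
    case False
    then have fp: "f' t > 0" using f'0[OF t] by simp
    have "ennreal (f' t) \<le> ennreal (g' t)"
      unfolding f'[OF t] g'[OF t]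
      by (intro nn_integral_mono ennreal_leI mult_left_mono) (auto simp: fg K t)
    \<comment> \<open>Negative reals are truncated to 0 by \<open>ennreal\<close>; positivity of
      \<open>f' t\<close> is what lets the inequality pass back to the reals.\<close>
    with fp have fg': "f' t \<le> g' t"
      by (metis ennreal_le_iff2 not_le order.strict_iff_not)
    \<comment> \<open>The output ratio at \<open>t\<close> is constant in \<open>u\<close>, so
      \<open>ln (1 / r)\<close> leaves the integral, and \<open>g' t * r = f' t\<close> makes the
      integrated tangent bound exactly the claim with \<open>f' t\<close> added on both sides. This
      finite summand keeps all terms nonnegative and is cancelled at the end.\<close>
    define r where "r = f' t / g' t"
    have r: "r > 0" "r \<le> 1" using fp fg' by (auto simp: r_def)
    have "(\<integral>\<^sup>+ u. ennreal (K u t * (f u * ln (g u / f u))) \<partial>T) + ennreal (f' t)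
       = (\<integral>\<^sup>+ u. ennreal (K u t * (f u * ln (g u / f u)) + K u t * f u) \<partial>T)"
      unfolding f'[OF t]
    proof (subst nn_integral_add[symmetric])
      show "(\<integral>\<^sup>+ u. ennreal (K u t * (f u * ln (g u / f u))) + ennreal (K u t * f u) \<partial>T)
        = (\<integral>\<^sup>+ u. ennreal (K u t * (f u * ln (g u / f u)) + K u t * f u) \<partial>T)"
        using mult_nonneg_nonneg[OF K[OF _ t] ln_nonneg] mult_nonneg_nonneg[OF K[OF _ t] f]
        by (intro nn_integral_cong ennreal_plus[symmetric])
    qed measurable
    also have "\<dots> \<le> (\<integral>\<^sup>+ u. ennreal (K u t * f u) * ennreal (ln (1 / r)) + ennreal (K u t * g u) * ennreal r \<partial>T)"
    proof (intro nn_integral_mono)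
      fix u assume u: "u \<in> space T"
      have "f u * ln (g u / f u) + f u \<le> f u * ln (1 / r) + g u * r"
      proof (cases "f u = 0")
        case True then show ?thesis using f[OF u] fg[OF u] r by simp
      next
        case False
        then have p: "f u > 0" "g u > 0" using f[OF u] fg[OF u] by auto
        have "ln (g u * r / f u) \<le> g u * r / f u - 1"
          using p r by (intro ln_le_minus_one) auto
        moreover have "ln (g u * r / f u) = ln (g u / f u) - ln (1 / r)"
          using p r by (simp add: ln_div ln_mult)
        ultimately have "f u * (ln (g u / f u) - ln (1 / r)) \<le> f u * (g u * r / f u - 1)"
          using p by (intro mult_left_mono) auto
        then show ?thesis using p by (simp add: algebra_simps)
      qed
      then have "K u t * (f u * ln (g u / f u) + f u) \<le> K u t * (f u * ln (1 / r) + g u * r)"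
        using K[OF u t] by (intro mult_left_mono)
      then have "K u t * (f u * ln (g u / f u)) + K u t * f u \<le> K u t * f u * ln (1 / r) + K u t * g u * r"
        by (simp add: algebra_simps)
      moreover have "0 \<le> ln (1 / r)" "0 \<le> g u" using r f[OF u] fg[OF u] by auto
      ultimately show "ennreal (K u t * (f u * ln (g u / f u)) + K u t * f u)
          \<le> ennreal (K u t * f u) * ennreal (ln (1 / r)) + ennreal (K u t * g u) * ennreal r"
        using r K[OF u t] f[OF u] by (simp add: ennreal_mult[symmetric] ennreal_plus[symmetric] ennreal_leI del: ennreal_plus)
    qed
    also have "\<dots> = ennreal (f' t) * ennreal (ln (1 / r)) + ennreal (g' t) * ennreal r"
      unfolding f'[OF t] g'[OF t]
      by (subst nn_integral_add) (auto simp: nn_integral_multc)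
    also have "\<dots> = ennreal (f' t * ln (g' t / f' t)) + ennreal (f' t)"
      using fp fg' r by (simp add: r_def ennreal_mult[symmetric] ennreal_plus[symmetric] del: ennreal_plus)
    finally show ?thesis
      by (simp add: ennreal_add_left_cancel_le add.commute[of _ "ennreal (f' t)"])
  qed
  \<comment> \<open>The total mass 1 of \<open>K u\<close> is inserted as an integral over
    \<open>t\<close>; Tonelli's theorem then exposes the inner integrals bounded in
    \<open>point\<close>.\<close>
  have "(\<integral>\<^sup>+ u. ennreal (f u * ln (g u / f u)) \<partial>T)
     = (\<integral>\<^sup>+ u. (\<integral>\<^sup>+ t. ennreal (K u t * (f u * ln (g u / f u))) \<partial>T') \<partial>T)"
  proof (intro nn_integral_cong)
    fix u assume u [measurable]: "u \<in> space T"
    have "(\<integral>\<^sup>+ t. ennreal (K u t * (f u * ln (g u / f u))) \<partial>T')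
      = (\<integral>\<^sup>+ t. ennreal (K u t) * ennreal (f u * ln (g u / f u)) \<partial>T')"
      using K[OF u] ln_nonneg[OF u] by (intro nn_integral_cong) (simp add: ennreal_mult)
    also have "\<dots> = ennreal (f u * ln (g u / f u))"
      by (subst nn_integral_multc) (auto simp: K1[OF u])
    finally show "ennreal (f u * ln (g u / f u)) = (\<integral>\<^sup>+ t. ennreal (K u t * (f u * ln (g u / f u))) \<partial>T')" ..
  qed
  also have "\<dots> = (\<integral>\<^sup>+ t. (\<integral>\<^sup>+ u. ennreal (K u t * (f u * ln (g u / f u))) \<partial>T) \<partial>T')"
    by (rule TT'.Fubini'[symmetric]) measurable
  also have "\<dots> \<le> (\<integral>\<^sup>+ t. ennreal (f' t * ln (g' t / f' t)) \<partial>T')"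
    by (intro nn_integral_mono point)
  finally show ?thesis .
qed

text \<open>For positive \<open>x\<close> the upper bound comes from \<open>ln a \<le> a - 1\<close>
  at \<open>a = y / x\<close>, which gives \<open>y - x\<close>. For \<open>x = 0\<close> every
  product vanishes, whatever value the logarithm takes. Domination by \<open>y\<close> later makes
  entropy terms integrable as soon as the marginal density is.\<close>

lemma entropy_term_bounds:
  fixes x y :: real
  assumes "0 \<le> x" "x \<le> y"
  shows "0 \<le> x * ln (y / x)" "x * ln (y / x) \<le> y" "x * ln (x / y) = - (x * ln (y / x))"
proof -
  consider "x = 0" | "x > 0" "y > 0" using assms by linarith
  then have "0 \<le> x * ln (y / x) \<and> x * ln (y / x) \<le> y \<and> x * ln (x / y) = - (x * ln (y / x))"
  proof cases
    case 2
    have "ln (x / y) = - ln (y / x)"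
      using 2 by (simp only: ln_div) simp
    moreover have "x * ln (y / x) \<le> x * (y / x - 1)"
      using 2 by (intro mult_left_mono ln_le_minus_one) auto
    moreover have "x * (y / x - 1) = y - x"
      using 2 by (simp add: field_simps)
    ultimately show ?thesis
      using 2 assms by (auto intro!: mult_nonneg_nonneg ln_ge_zero)
  qed (use assms in simp)
  then show "0 \<le> x * ln (y / x)" "x * ln (y / x) \<le> y" "x * ln (x / y) = - (x * ln (y / x))"
    by auto
qed

lemma integrable_entropy_term:
  fixes f g :: "'a \<Rightarrow> real"
  assumes [measurable]: "f \<in> borel_measurable T" and g: "integrable T g"
    and fg: "\<And>u. u \<in> space T \<Longrightarrow> 0 \<le> f u" "\<And>u. u \<in> space T \<Longrightarrow> f u \<le> g u"
  shows "integrable T (\<lambda>u. f u * ln (f u / g u))"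
proof (rule Bochner_Integration.integrable_bound[OF g])
  have [measurable]: "g \<in> borel_measurable T" using g by simp
  show "(\<lambda>u. f u * ln (f u / g u)) \<in> borel_measurable T" by measurable
  show "AE u in T. norm (f u * ln (f u / g u)) \<le> norm (g u)"
    using entropy_term_bounds[OF fg] fg by (intro AE_I2) (force intro: order_trans)
qed

text \<open>Bridge between the signed integrals in mutual information and the nonnegative ones in
  \<open>kernel_relative_entropy_nn\<close>: inverting the fraction under \<open>ln\<close> flips
  the sign. The second claim allows an inequality in \<open>ennreal\<close> to be read back in the
  reals.\<close>

lemma nn_integral_entropy_term:
  fixes f g :: "'a \<Rightarrow> real"
  assumes "f \<in> borel_measurable T" "integrable T g"
    and "\<And>u. u \<in> space T \<Longrightarrow> 0 \<le> f u" "\<And>u. u \<in> space T \<Longrightarrow> f u \<le> g u"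
  shows "ennreal (- (\<integral> u. f u * ln (f u / g u) \<partial>T)) = (\<integral>\<^sup>+ u. ennreal (f u * ln (g u / f u)) \<partial>T)"
    and "0 \<le> - (\<integral> u. f u * ln (f u / g u) \<partial>T)"
proof -
  note b = entropy_term_bounds[OF assms(3,4)]
  have "- (\<integral> u. f u * ln (f u / g u) \<partial>T) = (\<integral> u. - (f u * ln (f u / g u)) \<partial>T)"
    by simp
  also have "\<dots> = (\<integral> u. f u * ln (g u / f u) \<partial>T)"
    using b(3) by (intro Bochner_Integration.integral_cong) auto
  finally have eq: "- (\<integral> u. f u * ln (f u / g u) \<partial>T) = (\<integral> u. f u * ln (g u / f u) \<partial>T)" .
  have "integrable T (\<lambda>u. - (f u * ln (f u / g u)))"
    using integrable_entropy_term[OF assms] by simp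
  then have int: "integrable T (\<lambda>u. f u * ln (g u / f u))"
    by (rule Bochner_Integration.integrable_cong[OF refl, THEN iffD1, rotated]) (simp add: b(3))
  show "ennreal (- (\<integral> u. f u * ln (f u / g u) \<partial>T)) = (\<integral>\<^sup>+ u. ennreal (f u * ln (g u / f u)) \<partial>T)"
    unfolding eq by (rule nn_integral_eq_integral[symmetric]) (use int b(1) in auto)
  show "0 \<le> - (\<integral> u. f u * ln (f u / g u) \<partial>T)"
    unfolding eq by (rule Bochner_Integration.integral_nonneg) (use b(1) in auto)
qed

text \<open>Undoing the sign change of \<open>nn_integral_entropy_term\<close> reverses the
  inequality of \<open>kernel_relative_entropy_nn\<close>: relative entropy contracts under
  \<open>K\<close>.\<close>

lemma kernel_relative_entropy_le:
  fixes f g :: "'a \<Rightarrow> real" and f' g' :: "'b \<Rightarrow> real" and K :: "'a \<Rightarrow> 'b \<Rightarrow> real"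
  assumes T: "sigma_finite_measure T" and T': "sigma_finite_measure T'"
    and fm: "f \<in> borel_measurable T" and g: "integrable T g"
    and f'm: "f' \<in> borel_measurable T'" and g'i: "integrable T' g'"
    and Km: "case_prod K \<in> borel_measurable (T \<Otimes>\<^sub>M T')"
    and fg: "\<And>u. u \<in> space T \<Longrightarrow> 0 \<le> f u" "\<And>u. u \<in> space T \<Longrightarrow> f u \<le> g u"
    and fg': "\<And>t. t \<in> space T' \<Longrightarrow> 0 \<le> f' t" "\<And>t. t \<in> space T' \<Longrightarrow> f' t \<le> g' t"
    and K: "\<And>u t. u \<in> space T \<Longrightarrow> t \<in> space T' \<Longrightarrow> 0 \<le> K u t"
    and K1: "\<And>u. u \<in> space T \<Longrightarrow> (\<integral>\<^sup>+ t. ennreal (K u t) \<partial>T') = 1"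
    and f': "\<And>t. t \<in> space T' \<Longrightarrow> ennreal (f' t) = (\<integral>\<^sup>+ u. ennreal (K u t * f u) \<partial>T)"
    and g': "\<And>t. t \<in> space T' \<Longrightarrow> ennreal (g' t) = (\<integral>\<^sup>+ u. ennreal (K u t * g u) \<partial>T)"
  shows "(\<integral> t. f' t * ln (f' t / g' t) \<partial>T') \<le> (\<integral> u. f u * ln (f u / g u) \<partial>T)"
proof -
  note nn = nn_integral_entropy_term
  have "g \<in> borel_measurable T" using g by simp
  from kernel_relative_entropy_nn[OF T T' fm this Km fg K K1 fg'(1) f' g']
  have "ennreal (- (\<integral> u. f u * ln (f u / g u) \<partial>T)) \<le> ennreal (- (\<integral> t. f' t * ln (f' t / g' t) \<partial>T'))"
    by (simp only: nn(1)[OF fm g fg] nn(1)[OF f'm g'i fg'])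
  then show ?thesis
    using nn(2)[OF f'm g'i fg'] by (subst (asm) ennreal_le_iff) simp_all
qed

section \<open>Mutual information with a finite-valued variable\<close>

lemma (in prob_space) distributed_finite_vimage:
  fixes X :: "'a \<Rightarrow> 'x :: finite"
  assumes "X \<in> M \<rightarrow>\<^sub>M count_space UNIV"
  shows "distributed M (count_space UNIV) X (\<lambda>x. ennreal (prob (X -` {x} \<inter> space M)))"
  unfolding distributed_def
proof (intro conjI assms)
  show "distr M (count_space UNIV) X = density (count_space UNIV) (\<lambda>x. ennreal (prob (X -` {x} \<inter> space M)))"
  proof (rule measure_eqI_finite[where A = UNIV])
    fix x
    show "emeasure (distr M (count_space UNIV) X) {x} =
      emeasure (density (count_space UNIV) (\<lambda>x. ennreal (prob (X -` {x} \<inter> space M)))) {x}"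
      using assms by (simp add: emeasure_distr emeasure_density emeasure_eq_measure nn_integral_count_space_finite)
  qed auto
qed auto

text \<open>This is the entropy of \<open>X\<close> minus its conditional entropy given
  \<open>W\<close>, written with densities. The terms in \<open>P\<close> depend on \<open>X\<close>
  alone, so comparing two signals reduces to comparing, for each \<open>x\<close>, relative
  entropies of \<open>p x\<close> to the marginal density.\<close>

lemma (in information_space) mutual_information_finite:
  fixes X :: "'a \<Rightarrow> 'x :: finite" and W :: "'a \<Rightarrow> 't" and p :: "'x \<Rightarrow> 't \<Rightarrow> real"
  assumes T: "sigma_finite_measure T"
    and X: "X \<in> M \<rightarrow>\<^sub>M count_space UNIV"
    and D: "distributed M (count_space UNIV \<Otimes>\<^sub>M T) (\<lambda>\<omega>. (X \<omega>, W \<omega>)) (\<lambda>(x, t). ennreal (p x t))"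
    and p: "\<And>x t. 0 \<le> p x t"
  defines "P \<equiv> \<lambda>x. prob (X -` {x} \<inter> space M)"
  shows "p x \<in> borel_measurable T" "integrable T (p x)"
    and "mutual_information b (count_space UNIV) T X W
      = (\<Sum>x\<in>UNIV. (\<integral> t. p x t * log b (p x t / (\<Sum>x\<in>UNIV. p x t)) \<partial>T) - P x * log b (P x))"
proof -
  interpret T: sigma_finite_measure T by fact
  interpret S: sigma_finite_measure "count_space (UNIV :: 'x set)"
    by (rule sigma_finite_measure_count_space_finite) simp
  interpret ST: pair_sigma_finite "count_space (UNIV :: 'x set)" T ..
  define q where "q = (\<lambda>t. \<Sum>x\<in>UNIV. p x t)"
  have "(\<lambda>(x, t). p x t) \<in> borel_measurable (count_space UNIV \<Otimes>\<^sub>M T)"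
    using D p by (intro distributed_real_measurable[where X="\<lambda>\<omega>. (X \<omega>, W \<omega>)" and M=M])
      (auto simp: case_prod_unfold)
  note pm [measurable] = this
  have pxm [measurable]: "p x \<in> borel_measurable T" for x
    using measurable_compose[OF measurable_Pair1'[of x "count_space UNIV"] pm] by simp
  then show "p x \<in> borel_measurable T" .
  have [measurable]: "q \<in> borel_measurable T" unfolding q_def by measurable
  have q0: "0 \<le> q t" for t unfolding q_def by (intro sum_nonneg p)
  have pq: "p x t \<le> q t" for x t
    unfolding q_def by (rule member_le_sum) (auto simp: p)
  have Px: "distributed M (count_space UNIV) X (\<lambda>x. ennreal (P x))"
    unfolding P_def using X by (rule distributed_finite_vimage)
  have P: "(\<integral>\<^sup>+ t. ennreal (p x t) \<partial>T) = ennreal (P x)" for x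
    using distributed_marginal_eq_joint1[OF T S.sigma_finite_measure_axioms Px D]
    by (simp add: AE_count_space)
  show pi: "integrable T (p x)" for x
    by (rule integrableI_nn_integral_finite[OF _ _ P]) (auto simp: p)
  have P': "(\<integral> t. p x t \<partial>T) = P x" for x
    by (rule integral_eq_nn_integral[THEN trans]) (auto simp: p P P_def)
  have qi: "integrable T q" unfolding q_def by (intro Bochner_Integration.integrable_sum pi)
  have W: "distributed M T W (\<lambda>t. ennreal (q t))"
    using distr_marginal2[OF S.sigma_finite_measure_axioms T D]
    by (simp add: nn_integral_count_space_finite q_def sum_ennreal p)
  define F where "F = (\<lambda>(x, t). p x t * log b (p x t / (P x * q t)))"
  have Fm [measurable]: "F \<in> borel_measurable (count_space UNIV \<Otimes>\<^sub>M T)"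
    unfolding F_def by measurable
  \<comment> \<open>The logarithm of the product splits only for positive \<open>P x\<close>; if
    \<open>P x = 0\<close>, then \<open>p x\<close> vanishes almost everywhere and so do both
    sides.\<close>
  have AE0: "AE t in T. F (x, t) = p x t * log b (p x t / q t) - p x t * log b (P x)" for x
  proof (cases "P x = 0")
    case True
    then have "(\<integral>\<^sup>+ t. ennreal (p x t) \<partial>T) = 0" by (simp add: P)
    then have "AE t in T. ennreal (p x t) = 0"
      by (subst (asm) nn_integral_0_iff_AE) auto
    then have "AE t in T. p x t = 0"
      by eventually_elim (simp add: p antisym ennreal_eq_0_iff)
    then show ?thesis by eventually_elim (simp add: F_def)
  next
    case False
    then have "P x > 0" by (simp add: P_def zero_less_measure_iff)
    then have "F (x, t) = p x t * log b (p x t / q t) - p x t * log b (P x)" for t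
    proof (cases "p x t = 0")
      case False
      then have "p x t > 0" "q t > 0" using p[of x t] pq[of x t] by auto
      with \<open>P x > 0\<close> show ?thesis
        by (simp add: F_def log_divide log_mult algebra_simps)
    qed (simp add: F_def)
    then show ?thesis by simp
  qed
  have i1: "integrable T (\<lambda>t. p x t * log b (p x t / q t))" for x
    using integrable_entropy_term[OF pxm qi p pq, of x] unfolding log_def by simp
  have i2: "integrable T (\<lambda>t. p x t * log b (p x t / q t) - p x t * log b (P x))" for x
    using i1 pi by (intro Bochner_Integration.integrable_diff) auto
  \<comment> \<open>As \<open>x\<close> ranges over a finite type, integrability of each slice gives
    the joint integrability that Fubini's theorem requires.\<close>
  have i3: "integrable T (\<lambda>t. F (x, t))" for x
    using AE0[of x] by (intro integrable_cong_AE_imp[OF i2[of x]]) (measurable, simp add: eq_commute)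
  have "mutual_information b (count_space UNIV) T X W = integral\<^sup>L (count_space UNIV \<Otimes>\<^sub>M T) F"
    using mutual_information_distr[OF S.sigma_finite_measure_axioms T Px _ W q0, of "\<lambda>(x, t). p x t"] D p
    by (simp add: P_def F_def case_prod_unfold)
  also have "\<dots> = (\<integral> x. (\<integral> t. F (x, t) \<partial>T) \<partial>count_space UNIV)"
    by (rule ST.integral_fst'[symmetric], rule ST.Fubini_integrable)
      (auto intro!: i3 integrable_count_space)
  also have "\<dots> = (\<Sum>x\<in>UNIV. (\<integral> t. F (x, t) \<partial>T))"
    by (simp add: lebesgue_integral_count_space_finite)
  also have "\<dots> = (\<Sum>x\<in>UNIV. (\<integral> t. p x t * log b (p x t / q t) - p x t * log b (P x) \<partial>T))"
    by (intro sum.cong refl integral_cong_AE AE0) measurable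
  also have "\<dots> = (\<Sum>x\<in>UNIV. (\<integral> t. p x t * log b (p x t / q t) \<partial>T) - P x * log b (P x))"
    using i1 pi by (simp add: Bochner_Integration.integral_diff P')
  finally show "mutual_information b (count_space UNIV) T X W
      = (\<Sum>x\<in>UNIV. (\<integral> t. p x t * log b (p x t / (\<Sum>x\<in>UNIV. p x t)) \<partial>T) - P x * log b (P x))"
    unfolding q_def .
qed

text \<open>Only the joint laws with \<open>X\<close> enter: \<open>W'\<close> need not be computed
  from \<open>W\<close> on the sample space, it suffices that \<open>K\<close> carries the density
  \<open>p x\<close> to \<open>p' x\<close> for every \<open>x\<close>. The entropy of
  \<open>X\<close> is common to both sides, so the comparison is made term by term in
  \<open>x\<close>.\<close>

lemma (in information_space) data_processing_kernel:
  fixes X :: "'a \<Rightarrow> 'x :: finite" and W :: "'a \<Rightarrow> 't" and W' :: "'a \<Rightarrow> 's"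
    and p :: "'x \<Rightarrow> 't \<Rightarrow> real" and p' :: "'x \<Rightarrow> 's \<Rightarrow> real" and K :: "'t \<Rightarrow> 's \<Rightarrow> real"
  assumes T: "sigma_finite_measure T" and T': "sigma_finite_measure T'"
    and X: "X \<in> M \<rightarrow>\<^sub>M count_space UNIV"
    and D: "distributed M (count_space UNIV \<Otimes>\<^sub>M T) (\<lambda>\<omega>. (X \<omega>, W \<omega>)) (\<lambda>(x, t). ennreal (p x t))"
    and D': "distributed M (count_space UNIV \<Otimes>\<^sub>M T') (\<lambda>\<omega>. (X \<omega>, W' \<omega>)) (\<lambda>(x, t). ennreal (p' x t))"
    and p: "\<And>x t. 0 \<le> p x t" and p': "\<And>x t. 0 \<le> p' x t"
    and K: "\<And>u t. 0 \<le> K u t"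
    and Km: "case_prod K \<in> borel_measurable (T \<Otimes>\<^sub>M T')"
    and K1: "\<And>u. u \<in> space T \<Longrightarrow> (\<integral>\<^sup>+ t. ennreal (K u t) \<partial>T') = 1"
    and p'K: "\<And>x t. t \<in> space T' \<Longrightarrow> ennreal (p' x t) = (\<integral>\<^sup>+ u. ennreal (K u t * p x u) \<partial>T)"
  shows "mutual_information b (count_space UNIV) T' X W' \<le> mutual_information b (count_space UNIV) T X W"
proof -
  note m = mutual_information_finite[OF T X D p]
  note m' = mutual_information_finite[OF T' X D' p']
  have [measurable]: "case_prod K \<in> borel_measurable (T \<Otimes>\<^sub>M T')" by fact
  have [measurable]: "p x \<in> borel_measurable T" for x by (rule m(1))
  have "(\<integral> t. p' x t * ln (p' x t / (\<Sum>x\<in>UNIV. p' x t)) \<partial>T') \<le> (\<integral> t. p x t * ln (p x t / (\<Sum>x\<in>UNIV. p x t)) \<partial>T)" for x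
  proof (rule kernel_relative_entropy_le[OF T T' m(1) _ m'(1) _ Km])
    fix t assume t [measurable]: "t \<in> space T'"
    \<comment> \<open>Summing over \<open>x\<close> shows that the same kernel carries the marginal
      density to the marginal density.\<close>
    have "ennreal (\<Sum>x\<in>UNIV. p' x t) = (\<Sum>x\<in>UNIV. ennreal (p' x t))"
      by (rule sum_ennreal[symmetric]) (rule p')
    also have "\<dots> = (\<Sum>x\<in>UNIV. \<integral>\<^sup>+ u. ennreal (K u t * p x u) \<partial>T)"
      by (simp only: p'K[OF t])
    also have "\<dots> = (\<integral>\<^sup>+ u. (\<Sum>x\<in>UNIV. ennreal (K u t * p x u)) \<partial>T)"
      by (rule nn_integral_sum[symmetric]) measurable
    also have "\<dots> = (\<integral>\<^sup>+ u. ennreal (K u t * (\<Sum>x\<in>UNIV. p x u)) \<partial>T)"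
      by (intro nn_integral_cong) (simp add: sum_distrib_left K p)
    finally show "ennreal (\<Sum>x\<in>UNIV. p' x t) = (\<integral>\<^sup>+ u. ennreal (K u t * (\<Sum>x\<in>UNIV. p x u)) \<partial>T)" .
    show "p' x t \<le> (\<Sum>x\<in>UNIV. p' x t)"
      by (rule member_le_sum) (simp_all add: p')
  next
    fix u assume "u \<in> space T"
    show "p x u \<le> (\<Sum>x\<in>UNIV. p x u)"
      by (rule member_le_sum) (simp_all add: p)
  next
    show "integrable T (\<lambda>t. \<Sum>x\<in>UNIV. p x t)" "integrable T' (\<lambda>t. \<Sum>x\<in>UNIV. p' x t)"
      using m(2) m'(2) by (blast intro: Bochner_Integration.integrable_sum)+
  qed (erule K1 p'K | rule p p' K)+
  then have "(\<integral> t. p' x t * log b (p' x t / (\<Sum>x\<in>UNIV. p' x t)) \<partial>T') \<le> (\<integral> t. p x t * log b (p x t / (\<Sum>x\<in>UNIV. p x t)) \<partial>T)" for x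
    using b_gt_1 unfolding log_def times_divide_eq_right integral_divide_zero
    by (intro divide_right_mono) auto
  then show ?thesis
    unfolding m(3) m'(3) by (intro sum_mono diff_right_mono)
qed

section \<open>Joint densities of bits and received signals\<close>

text \<open>Law of total probability: given the label \<open>l\<close> the signal has density
  \<open>w l\<close>, and each label with \<open>X l = x\<close> contributes with weight
  \<open>1 / card A\<close>. The proof integrates out the noise for each label first.\<close>

lemma distributed_uniform_label:
  fixes A :: "'l set" and X :: "'l \<Rightarrow> 'x :: finite" and W :: "'l \<times> 'n \<Rightarrow> 't" and w :: "'l \<Rightarrow> 't \<Rightarrow> real"
  assumes A: "finite A" "A \<noteq> {}" and N: "prob_space N" and T: "sigma_finite_measure T"
    and [measurable]: "W \<in> measure_pmf (pmf_of_set A) \<Otimes>\<^sub>M N \<rightarrow>\<^sub>M T"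
    and w: "\<And>l t. 0 \<le> w l t"
    and D: "\<And>l. l \<in> A \<Longrightarrow> distributed N T (\<lambda>n. W (l, n)) (\<lambda>t. ennreal (w l t))"
  shows "distributed (measure_pmf (pmf_of_set A) \<Otimes>\<^sub>M N) (count_space UNIV \<Otimes>\<^sub>M T)
    (\<lambda>\<omega>. (X (fst \<omega>), W \<omega>)) (\<lambda>(x, t). ennreal (\<Sum>l\<in>A. of_bool (X l = x) * w l t / card A))"
    (is "distributed ?M ?ST ?XW (\<lambda>(x, t). ennreal (?p x t))")
proof -
  interpret N: prob_space N by fact
  interpret T: sigma_finite_measure T by fact
  have c: "real (card A) > 0" using A by (simp add: card_gt_0_iff)
  have [measurable]: "w l \<in> borel_measurable T" if "l \<in> A" for l
    using D[OF that] w by (intro distributed_real_measurable) auto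
  have [measurable]: "X \<in> measure_pmf (pmf_of_set A) \<rightarrow>\<^sub>M count_space UNIV" by simp
  have XW [measurable]: "?XW \<in> ?M \<rightarrow>\<^sub>M ?ST" by measurable
  have pm [measurable]: "(\<lambda>(x, t). ennreal (?p x t)) \<in> borel_measurable ?ST"
    by (rule measurable_pair_measure_countable1) (simp_all add: countable_finite)
  have "distr ?M ?ST ?XW = density ?ST (\<lambda>(x, t). ennreal (?p x t))"
  proof (rule measure_eqI)
    fix B assume "B \<in> sets (distr ?M ?ST ?XW)"
    then have B [measurable]: "B \<in> sets ?ST" by simp
    have [measurable]: "(\<lambda>t. indicator B (x, t) :: ennreal) \<in> borel_measurable T" for x
      by (rule measurable_compose[OF measurable_Pair1'[of x "count_space UNIV"]]) auto
    have "emeasure (distr ?M ?ST ?XW) B = (\<integral>\<^sup>+ \<omega>. indicator B (?XW \<omega>) \<partial>?M)"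
      by (subst nn_integral_indicator[symmetric], simp, subst nn_integral_distr) auto
    also have "\<dots> = (\<integral>\<^sup>+ l. (\<integral>\<^sup>+ n. indicator B (X l, W (l, n)) \<partial>N) \<partial>measure_pmf (pmf_of_set A))"
      by (subst N.nn_integral_fst[symmetric]) auto
    also have "\<dots> = (\<Sum>l\<in>A. (\<integral>\<^sup>+ n. indicator B (X l, W (l, n)) \<partial>N)) / card A"
      using A by (simp add: nn_integral_pmf_of_set)
    also have "\<dots> = (\<Sum>l\<in>A. (\<integral>\<^sup>+ n. indicator B (X l, W (l, n)) \<partial>N) * ennreal (1 / card A))"
      using c by (simp add: divide_ennreal_def sum_distrib_right inverse_ennreal inverse_eq_divide ennreal_of_nat_eq_real_of_nat)
    also have "\<dots> = (\<Sum>l\<in>A. (\<integral>\<^sup>+ t. ennreal (w l t) * indicator B (X l, t) \<partial>T) * ennreal (1 / card A))"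
      by (intro sum.cong refl arg_cong2[where f="(*)"] distributed_nn_integral[OF D, symmetric]) auto
    \<comment> \<open>A sum over all \<open>x\<close> is introduced in which only
      \<open>x = X l\<close> contributes; after swapping the sums it becomes the integral over the
      counting measure.\<close>
    also have "\<dots> = (\<Sum>l\<in>A. \<Sum>x\<in>UNIV. (\<integral>\<^sup>+ t. ennreal (of_bool (X l = x) * w l t / card A) * indicator B (x, t) \<partial>T))"
    proof (intro sum.cong refl)
      fix l assume l [measurable]: "l \<in> A"
      have "(\<Sum>x\<in>UNIV. (\<integral>\<^sup>+ t. ennreal (of_bool (X l = x) * w l t / card A) * indicator B (x, t) \<partial>T))
         = (\<Sum>x\<in>{X l}. (\<integral>\<^sup>+ t. ennreal (of_bool (X l = x) * w l t / card A) * indicator B (x, t) \<partial>T))"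
        by (rule sum.mono_neutral_right) auto
      also have "\<dots> = (\<integral>\<^sup>+ t. ennreal (w l t) * indicator B (X l, t) * ennreal (1 / card A) \<partial>T)"
        using w c by (auto intro!: nn_integral_cong simp: ennreal_mult[symmetric] mult_ac split: split_indicator)
      also have "\<dots> = (\<integral>\<^sup>+ t. ennreal (w l t) * indicator B (X l, t) \<partial>T) * ennreal (1 / card A)"
        by (rule nn_integral_multc) measurable
      finally show "(\<integral>\<^sup>+ t. ennreal (w l t) * indicator B (X l, t) \<partial>T) * ennreal (1 / card A) = (\<Sum>x\<in>UNIV. (\<integral>\<^sup>+ t. ennreal (of_bool (X l = x) * w l t / card A) * indicator B (x, t) \<partial>T))" ..
    qed
    also have "\<dots> = (\<Sum>x\<in>UNIV. \<Sum>l\<in>A. (\<integral>\<^sup>+ t. ennreal (of_bool (X l = x) * w l t / card A) * indicator B (x, t) \<partial>T))"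
      by (rule sum.swap)
    also have "\<dots> = (\<Sum>x\<in>UNIV. (\<integral>\<^sup>+ t. ennreal (?p x t) * indicator B (x, t) \<partial>T))"
      by (intro sum.cong refl, subst nn_integral_sum[symmetric])
        (auto intro!: nn_integral_cong simp: sum_distrib_right[symmetric] sum_ennreal w)
    also have "\<dots> = (\<integral>\<^sup>+ x. (\<integral>\<^sup>+ t. ennreal (?p x t) * indicator B (x, t) \<partial>T) \<partial>count_space UNIV)"
      by (simp add: nn_integral_count_space_finite)
    also have "\<dots> = (\<integral>\<^sup>+ y. (case y of (x, t) \<Rightarrow> ennreal (?p x t)) * indicator B y \<partial>?ST)"
      by (subst T.nn_integral_fst[symmetric]) auto
    also have "\<dots> = emeasure (density ?ST (\<lambda>(x, t). ennreal (?p x t))) B"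
      by (rule emeasure_density[symmetric]) measurable
    finally show "emeasure (distr ?M ?ST ?XW) B = emeasure (density ?ST (\<lambda>(x, t). ennreal (?p x t))) B" .
  qed simp
  then show ?thesis
    unfolding distributed_def using XW pm by simp
qed

text \<open>Mutual information sees its reference spaces only through their measurable sets. This
  allows \<open>borel\<close>, used in the rates, to be replaced by \<open>lborel\<close>, with
  respect to which the signals have densities.\<close>

lemma (in prob_space) mutual_information_cong_sets:
  assumes "sets S = sets S'" "sets T = sets T'"
  shows "mutual_information b S T X Y = mutual_information b S' T' X Y"
proof -
  have "distr M S X = distr M S' X" "distr M T Y = distr M T' Y"
    "distr M (S \<Otimes>\<^sub>M T) (\<lambda>\<omega>. (X \<omega>, Y \<omega>)) = distr M (S' \<Otimes>\<^sub>M T') (\<lambda>\<omega>. (X \<omega>, Y \<omega>))"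
    using assms by (auto intro!: distr_cong sets_pair_measure_cong)
  then show ?thesis by (simp add: mutual_information_def)
qed

lemma distributed_noise_shift:
  "distributed (noise \<sigma>) lborel (\<lambda>n. z + n) (\<lambda>y. ennreal (awgn_density \<sigma> z y))"
proof -
  have m: "(\<lambda>n. z + n) \<in> noise \<sigma> \<rightarrow>\<^sub>M lborel"
    by (simp add: noise_def)
  have "distr (noise \<sigma>) lborel (\<lambda>n. z + n) = density lborel (\<lambda>y. ennreal (awgn_density \<sigma> z y))"
  proof (rule measure_eqI)
    fix A assume "A \<in> sets (distr (noise \<sigma>) lborel (\<lambda>n. z + n))"
    then have A [measurable]: "A \<in> sets borel" by simp
    have "emeasure (distr (noise \<sigma>) lborel (\<lambda>n. z + n)) A = (\<integral>\<^sup>+ n. indicator A (z + n) \<partial>noise \<sigma>)"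
      using m by (subst nn_integral_indicator[symmetric], simp, subst nn_integral_distr) auto
    also have "\<dots> = (\<integral>\<^sup>+ n. ennreal (awgn_density \<sigma> 0 n) * indicator A (z + n) \<partial>lborel)"
      unfolding noise_def by (subst nn_integral_density) auto
    also have "\<dots> = (\<integral>\<^sup>+ n. ennreal (awgn_density \<sigma> z (z + n)) * indicator A (z + n) \<partial>lborel)"
      by (simp add: awgn_density_shift[of \<sigma> z])
    also have "\<dots> = (\<integral>\<^sup>+ y. ennreal (awgn_density \<sigma> z y) * indicator A y \<partial>distr lborel borel ((+) z))"
      by (subst nn_integral_distr) auto
    also have "\<dots> = emeasure (density lborel (\<lambda>y. ennreal (awgn_density \<sigma> z y))) A"
      by (simp add: lborel_distr_plus emeasure_density)
    finally show "emeasure (distr (noise \<sigma>) lborel (\<lambda>n. z + n)) A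
      = emeasure (density lborel (\<lambda>y. ennreal (awgn_density \<sigma> z y))) A" .
  qed simp
  with m show ?thesis by (simp add: distributed_def)
qed

text \<open>Used for the conditioning in the low-priority rate: once the label is fixed, the
  high-priority bits are a constant appended to the signal, with a point mass as density for the
  counting measure.\<close>

lemma distributed_pair_const:
  fixes c :: "'c :: countable"
  assumes D: "distributed N T Y (\<lambda>y. ennreal (f y))" and f: "\<And>y. 0 \<le> f y"
  shows "distributed N (T \<Otimes>\<^sub>M count_space UNIV) (\<lambda>n. (Y n, c)) (\<lambda>(y, c'). ennreal (f y * of_bool (c' = c)))"
    (is "distributed N ?TC ?YC ?g")
proof -
  interpret C: sigma_finite_measure "count_space (UNIV :: 'c set)"
    by (rule sigma_finite_measure_count_space)
  have [measurable]: "f \<in> borel_measurable T" "Y \<in> N \<rightarrow>\<^sub>M T"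
    using D f distributed_measurable[OF D] by (auto intro: distributed_real_measurable)
  have YC [measurable]: "?YC \<in> N \<rightarrow>\<^sub>M ?TC" by measurable
  have g [measurable]: "?g \<in> borel_measurable ?TC" by measurable
  have "distr N ?TC ?YC = density ?TC ?g"
  proof (rule measure_eqI)
    fix A assume "A \<in> sets (distr N ?TC ?YC)"
    then have A [measurable]: "A \<in> sets ?TC" by simp
    have [measurable]: "(\<lambda>y. indicator A (y, c) :: ennreal) \<in> borel_measurable T"
      by (rule measurable_compose[OF measurable_Pair2'[of c "count_space UNIV"]]) auto
    have "emeasure (distr N ?TC ?YC) A = (\<integral>\<^sup>+ n. indicator A (Y n, c) \<partial>N)"
      by (subst nn_integral_indicator[symmetric], simp, subst nn_integral_distr) auto
    also have "\<dots> = (\<integral>\<^sup>+ y. ennreal (f y) * indicator A (y, c) \<partial>T)"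
      by (rule distributed_nn_integral[OF D, symmetric]) measurable
    also have "\<dots> = (\<integral>\<^sup>+ y. (\<integral>\<^sup>+ c'. ?g (y, c') * indicator A (y, c') \<partial>count_space UNIV) \<partial>T)"
    proof (rule nn_integral_cong)
      fix y
      have "(\<integral>\<^sup>+ c'. ?g (y, c') * indicator A (y, c') \<partial>count_space UNIV)
        = (\<Sum>c'\<in>{c}. ?g (y, c') * indicator A (y, c'))"
        by (rule nn_integral_count_space') auto
      then show "ennreal (f y) * indicator A (y, c)
        = (\<integral>\<^sup>+ c'. ?g (y, c') * indicator A (y, c') \<partial>count_space UNIV)"
        by (simp only: prod.case sum.insert finite.emptyI empty_iff not_False_eq_True sum.empty add_0_right) simp
    qed
    also have "\<dots> = (\<integral>\<^sup>+ x. ?g x * indicator A x \<partial>?TC)"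
      by (subst C.nn_integral_fst[symmetric]) auto
    also have "\<dots> = emeasure (density ?TC ?g) A"
      by (rule emeasure_density[symmetric]) measurable
    finally show "emeasure (distr N ?TC ?YC) A = emeasure (density ?TC ?g) A" .
  qed simp
  then show ?thesis using YC g by (simp add: distributed_def)
qed

section \<open>Data processing for degraded channels\<close>

text \<open>The kernel identity has to be checked only for each label separately: the joint
  densities are mixtures over labels with weights common to both signals, and integration against
  \<open>K\<close> is linear. The signal space \<open>T\<close> is left general, to cover both a
  bare received signal and one paired with the high-priority bits.\<close>

lemma channel_data_processing:
  fixes X :: "label \<Rightarrow> 'x :: finite" and W W' :: "label \<times> complex \<Rightarrow> 't"
    and w w' :: "label \<Rightarrow> 't \<Rightarrow> real" and K :: "'t \<Rightarrow> 't \<Rightarrow> real"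
  assumes \<sigma>: "\<sigma> \<noteq> 0" and T: "sigma_finite_measure T"
    and W: "W \<in> channel_space mH mL \<sigma> \<rightarrow>\<^sub>M T" "\<And>l. distributed (noise \<sigma>) T (\<lambda>n. W (l, n)) (\<lambda>t. ennreal (w l t))"
    and W': "W' \<in> channel_space mH mL \<sigma> \<rightarrow>\<^sub>M T" "\<And>l. distributed (noise \<sigma>) T (\<lambda>n. W' (l, n)) (\<lambda>t. ennreal (w' l t))"
    and w: "\<And>l t. 0 \<le> w l t" and w': "\<And>l t. 0 \<le> w' l t"
    and K: "\<And>u t. 0 \<le> K u t"
    and Km [measurable]: "case_prod K \<in> borel_measurable (T \<Otimes>\<^sub>M T)"
    and K1: "\<And>u. u \<in> space T \<Longrightarrow> (\<integral>\<^sup>+ t. ennreal (K u t) \<partial>T) = 1"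
    and w'K: "\<And>l t. t \<in> space T \<Longrightarrow> ennreal (w' l t) = (\<integral>\<^sup>+ u. ennreal (K u t * w l u) \<partial>T)"
  shows "prob_space.mutual_information (channel_space mH mL \<sigma>) 2 (count_space UNIV) T (\<lambda>\<omega>. X (fst \<omega>)) W'
    \<le> prob_space.mutual_information (channel_space mH mL \<sigma>) 2 (count_space UNIV) T (\<lambda>\<omega>. X (fst \<omega>)) W"
proof -
  let ?A = "labels mH mL"
  let ?p = "\<lambda>w x t. \<Sum>l\<in>?A. of_bool (X l = x) * w l t / card ?A"
  interpret prob_space "channel_space mH mL \<sigma>"
    by (rule prob_space_channel_space) fact
  interpret information_space "channel_space mH mL \<sigma>" 2
    by unfold_locales simp
  have D: "distributed (channel_space mH mL \<sigma>) (count_space UNIV \<Otimes>\<^sub>M T) (\<lambda>\<omega>. (X (fst \<omega>), V \<omega>)) (\<lambda>(x, t). ennreal (?p v x t))"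
    if "V \<in> channel_space mH mL \<sigma> \<rightarrow>\<^sub>M T" "\<And>l. distributed (noise \<sigma>) T (\<lambda>n. V (l, n)) (\<lambda>t. ennreal (v l t))"
      "\<And>l t. 0 \<le> v l t" for V v
    using that T unfolding channel_space_def
    by (intro distributed_uniform_label labels_finite_nonempty prob_space_noise \<sigma>) auto
  have wm [measurable]: "w l \<in> borel_measurable T" for l
    using distributed_real_measurable[OF w W(2)] .
  have Xm: "(\<lambda>\<omega>. X (fst \<omega>)) \<in> channel_space mH mL \<sigma> \<rightarrow>\<^sub>M count_space UNIV"
    unfolding channel_space_def by (rule measurable_compose[OF measurable_fst]) simp
  show ?thesis
  proof (rule data_processing_kernel[OF T T Xm D[OF W w] D[OF W' w'] _ _ K Km K1])
    fix x t assume t [measurable]: "t \<in> space T"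
    have "ennreal (?p w' x t) = (\<Sum>l\<in>?A. ennreal (of_bool (X l = x) * w' l t / card ?A))"
      by (rule sum_ennreal[symmetric]) (simp add: w')
    also have "\<dots> = (\<Sum>l\<in>?A. ennreal (of_bool (X l = x) / card ?A) * ennreal (w' l t))"
      by (intro sum.cong refl) (simp add: w' ennreal_mult[symmetric])
    also have "\<dots> = (\<Sum>l\<in>?A. \<integral>\<^sup>+ u. ennreal (of_bool (X l = x) / card ?A) * ennreal (K u t * w l u) \<partial>T)"
      unfolding w'K[OF t] by (intro sum.cong refl nn_integral_cmult[symmetric]) measurable
    also have "\<dots> = (\<integral>\<^sup>+ u. (\<Sum>l\<in>?A. ennreal (of_bool (X l = x) / card ?A) * ennreal (K u t * w l u)) \<partial>T)"
      by (rule nn_integral_sum[symmetric]) measurable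
    also have "\<dots> = (\<integral>\<^sup>+ u. (\<Sum>l\<in>?A. ennreal (K u t * (of_bool (X l = x) * w l u / card ?A))) \<partial>T)"
      by (intro nn_integral_cong sum.cong refl) (simp add: w K ennreal_mult[symmetric])
    also have "\<dots> = (\<integral>\<^sup>+ u. ennreal (K u t * ?p w x u) \<partial>T)"
      by (intro nn_integral_cong) (simp add: sum_distrib_left w K)
    finally show "ennreal (?p w' x t) = (\<integral>\<^sup>+ u. ennreal (K u t * ?p w x u) \<partial>T)" .
  qed (simp_all add: sum_nonneg divide_nonneg_nonneg mult_nonneg_nonneg w w')
qed

text \<open>By \<open>awgn_density_mult\<close> the integrand is
  \<open>awgn_density \<sigma> z y\<close> times a Gaussian density in \<open>u\<close>, which has
  mass 1. One \<open>s\<close> serves all \<open>z\<close>, so the kernel does not depend on the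
  transmitted label.\<close>

lemma awgn_degradation:
  assumes "\<rho> > 1" "\<sigma> \<noteq> 0"
  obtains s where "s \<noteq> 0"
    and "\<And>z y. (\<integral>\<^sup>+ u. ennreal (awgn_density s (u / of_real \<rho>) y * awgn_density \<sigma> (of_real \<rho> * z) u) \<partial>lborel)
      = ennreal (awgn_density \<sigma> z y)"
proof
  let ?s = "sqrt (\<sigma>\<^sup>2 * (1 - 1 / \<rho>\<^sup>2))"
  have "\<rho>\<^sup>2 > 1" using assms by (simp add: one_less_power)
  then have "1 / \<rho>\<^sup>2 \<noteq> 1" by (metis divide_eq_1_iff less_irrefl)
  then have "\<sigma>\<^sup>2 * (1 - 1 / \<rho>\<^sup>2) \<noteq> 0" using assms(2) by simp
  then show "?s \<noteq> 0" by simp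
  then show "(\<integral>\<^sup>+ u. ennreal (awgn_density ?s (u / of_real \<rho>) y * awgn_density \<sigma> (of_real \<rho> * z) u) \<partial>lborel)
      = ennreal (awgn_density \<sigma> z y)" for z y
    by (simp add: awgn_density_mult[OF assms] ennreal_mult awgn_density_nonneg nn_integral_cmult nn_integral_awgn_density)
qed

section \<open>Comparison of the two rates\<close>

theorem mainTheorem2:
  fixes mH mL :: nat and \<sigma>H \<sigma>L \<rho> :: real and z :: "bool list \<times> bool list \<Rightarrow> complex"
  assumes "mH \<ge> 1" and "mL \<ge> 1"
    and "0 < \<sigma>L\<^sup>2" and "\<sigma>L\<^sup>2 \<le> \<sigma>H\<^sup>2"
    and "\<rho> > 1"
  shows "rate_H mH mL \<sigma>H (\<lambda>b. complex_of_real \<rho> * z b) \<ge> rate_H mH mL \<sigma>H z \<and>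
         rate_L mH mL \<sigma>L (\<lambda>b. complex_of_real \<rho> * z b) \<ge> rate_L mH mL \<sigma>L z"
proof
  have \<sigma>L: "\<sigma>L \<noteq> 0" and \<sigma>H: "\<sigma>H \<noteq> 0" using assms by auto
  let ?z = "\<lambda>b. complex_of_real \<rho> * z b"
  have recv: "distributed (noise \<sigma>) lborel (\<lambda>n. received x (l, n)) (\<lambda>y. ennreal (awgn_density \<sigma> (x l) y))" for \<sigma> x l
    using distributed_noise_shift by (simp add: received_def)
  show "rate_H mH mL \<sigma>H z \<le> rate_H mH mL \<sigma>H ?z"
    unfolding rate_H_def
  proof (rule sum_mono)
    fix i
    interpret prob_space "channel_space mH mL \<sigma>H" by (rule prob_space_channel_space) fact
    obtain s where s: "s \<noteq> 0"
      "\<And>z y. (\<integral>\<^sup>+ u. ennreal (awgn_density s (u / of_real \<rho>) y * awgn_density \<sigma>H (of_real \<rho> * z) u) \<partial>lborel)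
        = ennreal (awgn_density \<sigma>H z y)"
      using awgn_degradation[OF \<open>\<rho> > 1\<close> \<sigma>H] by blast
    \<comment> \<open>Here \<open>received ?z\<close> is the input of the kernel and
      \<open>received z\<close> has the law of its output. The bit is written as a function of
      \<open>fst \<omega>\<close> to match \<open>channel_data_processing\<close>.\<close>
    have "mutual_information 2 (count_space UNIV) lborel (\<lambda>\<omega>. (\<lambda>l. fst l ! i) (fst \<omega>)) (received z)
      \<le> mutual_information 2 (count_space UNIV) lborel (\<lambda>\<omega>. (\<lambda>l. fst l ! i) (fst \<omega>)) (received ?z)"
      by (rule channel_data_processing[OF \<sigma>H sigma_finite_lborel _ recv _ recv, where K = "\<lambda>u. awgn_density s (u / of_real \<rho>)"])
        (simp_all add: awgn_density_nonneg nn_integral_awgn_density s)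
    then show "mutual_information 2 (count_space UNIV) borel (\<lambda>\<omega>. high_bits \<omega> ! i) (received z)
      \<le> mutual_information 2 (count_space UNIV) borel (\<lambda>\<omega>. high_bits \<omega> ! i) (received ?z)"
      by (simp add: high_bits_def mutual_information_cong_sets[OF refl sets_lborel])
  qed
  show "rate_L mH mL \<sigma>L z \<le> rate_L mH mL \<sigma>L ?z"
    unfolding rate_L_def
  proof (rule sum_mono)
    fix j
    interpret prob_space "channel_space mH mL \<sigma>L" by (rule prob_space_channel_space) fact
    \<comment> \<open>Bit strings form an infinite but countable type, so the counting measure is
      sigma-finite.\<close>
    interpret C: sigma_finite_measure "count_space (UNIV :: bool list set)"
      by (rule sigma_finite_measure_count_space)
    interpret LC: pair_sigma_finite "lborel :: complex measure" "count_space (UNIV :: bool list set)" ..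
    obtain s where s: "s \<noteq> 0"
      "\<And>z y. (\<integral>\<^sup>+ u. ennreal (awgn_density s (u / of_real \<rho>) y * awgn_density \<sigma>L (of_real \<rho> * z) u) \<partial>lborel)
        = ennreal (awgn_density \<sigma>L z y)"
      using awgn_degradation[OF \<open>\<rho> > 1\<close> \<sigma>L] by blast
    let ?T = "lborel \<Otimes>\<^sub>M count_space UNIV :: (complex \<times> bool list) measure"
    \<comment> \<open>The kernel degrades the signal as for the high-priority rate and copies the
      high-priority bits unchanged.\<close>
    let ?K = "\<lambda>(u, c) (y, c'). awgn_density s (u / of_real \<rho>) y * of_bool (c' = c)"
    let ?w = "\<lambda>x l (y, c'). awgn_density \<sigma>L (x l) y * of_bool (c' = fst l)"
    have D: "distributed (noise \<sigma>L) ?T (\<lambda>n. (received x (l, n), high_bits (l, n))) (\<lambda>t. ennreal (?w x l t))" for x l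
      using distributed_pair_const[OF recv[of \<sigma>L x l] awgn_density_nonneg, of "fst l"]
      by (simp add: high_bits_def case_prod_unfold)
    have M: "(\<lambda>\<omega>. (received x \<omega>, high_bits \<omega>)) \<in> channel_space mH mL \<sigma>L \<rightarrow>\<^sub>M ?T" for x
      by measurable
    \<comment> \<open>Comparing information about the pair of signal and high-priority bits is
      enough: the term subtracted by the chain rule does not involve the received signal and is the
      same for both constellations.\<close>
    have "mutual_information 2 (count_space UNIV) ?T (\<lambda>\<omega>. (\<lambda>l. snd l ! j) (fst \<omega>)) (\<lambda>\<omega>. (received z \<omega>, high_bits \<omega>))
      \<le> mutual_information 2 (count_space UNIV) ?T (\<lambda>\<omega>. (\<lambda>l. snd l ! j) (fst \<omega>)) (\<lambda>\<omega>. (received ?z \<omega>, high_bits \<omega>))"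
    proof (rule channel_data_processing[OF \<sigma>L LC.sigma_finite_measure_axioms M D M D, where K = ?K])
      show "case_prod ?K \<in> borel_measurable (?T \<Otimes>\<^sub>M ?T)"
        unfolding case_prod_unfold by measurable
      fix u :: "complex \<times> bool list"
      show "(\<integral>\<^sup>+ t. ennreal (?K u t) \<partial>?T) = 1"
      proof -
        have "(\<integral>\<^sup>+ t. ennreal (?K u t) \<partial>?T)
          = (\<integral>\<^sup>+ y. (\<integral>\<^sup>+ c'. ennreal (awgn_density s (fst u / of_real \<rho>) y * of_bool (c' = snd u)) \<partial>count_space UNIV) \<partial>lborel)"
          unfolding case_prod_unfold by (subst C.nn_integral_fst[symmetric]) auto
        also have "\<dots> = (\<integral>\<^sup>+ y. ennreal (awgn_density s (fst u / of_real \<rho>) y) \<partial>lborel)"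
          by (intro nn_integral_cong, subst nn_integral_count_space'[where A = "{snd u}"]) auto
        finally show ?thesis by (simp add: nn_integral_awgn_density s)
      qed
    next
      fix l and t :: "complex \<times> bool list"
      \<comment> \<open>The integral over \<open>c\<close> collapses to \<open>c = fst l\<close>, so
        the copying condition becomes \<open>snd t = fst l\<close>, which is constant in
        \<open>y\<close>; what remains is the identity \<open>s(2)\<close>.\<close>
      have "(\<integral>\<^sup>+ u. ennreal (?K u t * ?w ?z l u) \<partial>?T)
        = (\<integral>\<^sup>+ y. (\<integral>\<^sup>+ c. ennreal (awgn_density s (y / of_real \<rho>) (fst t) * of_bool (snd t = c)
            * (awgn_density \<sigma>L (?z l) y * of_bool (c = fst l))) \<partial>count_space UNIV) \<partial>lborel)"
        unfolding case_prod_unfold by (subst C.nn_integral_fst[symmetric]) auto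
      also have "\<dots> = (\<integral>\<^sup>+ y. ennreal (awgn_density s (y / of_real \<rho>) (fst t) * awgn_density \<sigma>L (?z l) y)
          * of_bool (snd t = fst l) \<partial>lborel)"
        by (intro nn_integral_cong, subst nn_integral_count_space'[where A = "{fst l}"]) auto
      also have "\<dots> = ennreal (?w z l t)"
        by (simp add: nn_integral_multc s(2) case_prod_unfold)
      finally show "ennreal (?w z l t) = (\<integral>\<^sup>+ u. ennreal (?K u t * ?w ?z l u) \<partial>?T)" ..
    qed (auto simp: awgn_density_nonneg)
    moreover have "sets ?T = sets (borel \<Otimes>\<^sub>M count_space UNIV)"
      by (intro sets_pair_measure_cong) auto
    ultimately show "conditional_mutual_information 2 (count_space UNIV) borel (count_space UNIV)
        (\<lambda>\<omega>. low_bits \<omega> ! j) (received z) high_bits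
      \<le> conditional_mutual_information 2 (count_space UNIV) borel (count_space UNIV)
        (\<lambda>\<omega>. low_bits \<omega> ! j) (received ?z) high_bits"
      unfolding conditional_mutual_information_def low_bits_def
      by (simp add: mutual_information_cong_sets[OF refl, of ?T "borel \<Otimes>\<^sub>M count_space UNIV", symmetric])
  qed
qed

end
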